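(* Let $m\ge 2$, $M=\{1,\dots,m\}$, $I=\{1,\dots,a\}$, and let $f_i:\mathbb{R}^n\to\mathbb{R}$ ($i\in M$) and $g_i:\mathbb{R}^n\to\mathbb{R}$ ($i\in I$) be twice continuously differentiable. Consider the constrained multi-objective problem $$(\mathrm{CMOP})\qquad \min\ F(x)=(f_1(x),\dots,f_m(x))^T\quad\text{s.t. } g_i(x)\le 0,\ i\in I.$$ Let $\hat{x}\in\mathbb{R}^n$ be a fixed reference point and consider the single-objective problem $$(\mathrm{P2})\qquad \min\ \sum_{i=1}^m f_i(x)\quad\text{s.t. } f_i(x)\le f_i(\hat{x}),\ i\in M;\quad g_i(x)\le 0,\ i\in I.$$ If $x^*\in\mathbb{R}^n$ is a KKT point of $(\mathrm{P2})$, then $x^*$ is a Pareto critical point of $(\mathrm{CMOP})$.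
   Context: KKT point of (P2): $x^*$ is a KKT point of $(\mathrm{P2})$ if there exist multipliers $\mu_i\ge 0$ ($i\in M$) and $\lambda_i\ge 0$ ($i\in I$) such that $$\sum_{i=1}^m\nabla f_i(x^* )+\sum_{i=1}^m\mu_i\nabla f_i(x^* )+\sum_{i\in I}\lambda_i\nabla g_i(x^* )=0,$$ $g_i(x^* )\le 0$ and $\lambda_i g_i(x^* )=0$ for all $i\in I$, and $f_i(x^* )-f_i(\hat{x})\le 0$ and $\mu_i(f_i(x^* )-f_i(\hat{x}))=0$ for all $i\in M$. Pareto critical point of (CMOP): $x^*$ is a Pareto critical point of $(\mathrm{CMOP})$ if there exist weights $w_i\ge 0$ ($i\in M$), at least one of which is strictly positive, such that $x^*$ is a KKT point of the weighted-sum problem $$\min\ \sum_{i=1}^m w_i f_i(x)\quad\text{s.t. } g_i(x)\le 0,\ i\in I,$$ that is, there exist $\lambda_i\ge 0$ ($i\in I$) with $\sum_{i=1}^m w_i\nabla f_i(x^* )+\sum_{i\in I}\lambda_i\nabla g_i(x^* )=0$, and $g_i(x^* )\le 0$, $\lambda_i g_i(x^* )=0$ for all $i\in I$. *)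

theory Defs
  imports "HOL-Analysis.Analysis"
begin

definition gradient :: "('a::real_inner \<Rightarrow> real) \<Rightarrow> 'a \<Rightarrow> 'a" where
  "gradient f x = (THE D. GDERIV f x :> D)"

lemma gradient_eqI:
  assumes "GDERIV f x :> D"
  shows "gradient f x = D"
  unfolding gradient_def
proof (rule the_equality)
  show "GDERIV f x :> D"
    by fact
  show "D' = D" if "GDERIV f x :> D'" for D'
  proof -
    have "(\<lambda>h. h \<bullet> D') = (\<lambda>h. h \<bullet> D)"
      using has_derivative_unique[OF that[unfolded gderiv_def] assms[unfolded gderiv_def]] .
    then have "\<forall>h. h \<bullet> D' = h \<bullet> D"
      unfolding fun_eq_iff .
    then show ?thesis
      by (rule vector_eq_ldot[THEN iffD1])
  qed
qed

lemma GDERIV_gradient: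
  fixes f :: "'a::euclidean_space \<Rightarrow> real"
  assumes "f differentiable at x"
  shows "GDERIV f x :> gradient f x"
proof -
  obtain f' where f': "(f has_derivative f') (at x)"
    using assms by (auto simp: differentiable_def)
  have "h \<bullet> adjoint f' 1 = f' h" for h
    using adjoint_works[OF has_derivative_linear[OF f'], of h 1]
    by (simp only: inner_real_def mult_1_right)
  then have "(\<lambda>h. h \<bullet> adjoint f' 1) = f'"
    by (rule ext)
  with f' have "GDERIV f x :> adjoint f' 1"
    by (simp only: gderiv_def)
  then show ?thesis
    by (simp only: gradient_eqI)
qed

text \<open>
  The matrix-valued function \<open>H\<close> is the Hessian of \<open>f\<close>. Its continuity is that of all
  second-order partial derivatives; continuity of \<open>f\<close> and of its gradient follows from
  their differentiability.
\<close>

definition twice_continuously_differentiable :: "(real ^ 'n \<Rightarrow> real) \<Rightarrow> bool" where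
  "twice_continuously_differentiable f \<longleftrightarrow>
     (\<forall>x. f differentiable at x) \<and>
     (\<exists>H :: real ^ 'n \<Rightarrow> real ^ 'n ^ 'n.
        (\<forall>x. (gradient f has_derivative (\<lambda>h. H x *v h)) (at x)) \<and>
        continuous_on UNIV H)"

text \<open>
  The objectives are \<open>f 1, \<dots>, f m\<close> and the inequality constraints are
  \<open>g i x \<le> 0\<close> for \<open>i = 1, \<dots>, a\<close>; values of \<open>f\<close> and \<open>g\<close> at other
  indices play no role, and \<open>a = 0\<close> means that there are no constraints.
  The point \<open>xhat\<close> is the reference point.
\<close>

definition KKT_point_P2 ::
  "nat \<Rightarrow> nat \<Rightarrow> (nat \<Rightarrow> real ^ 'n \<Rightarrow> real) \<Rightarrow> (nat \<Rightarrow> real ^ 'n \<Rightarrow> real) \<Rightarrow>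
   real ^ 'n \<Rightarrow> real ^ 'n \<Rightarrow> bool" where
  "KKT_point_P2 m a f g xhat x \<longleftrightarrow>
     (\<exists>(\<mu> :: nat \<Rightarrow> real) (lam :: nat \<Rightarrow> real).
        (\<forall>i\<in>{1..m}. 0 \<le> \<mu> i) \<and> (\<forall>i\<in>{1..a}. 0 \<le> lam i) \<and>
        (\<Sum>i=1..m. gradient (f i) x) + (\<Sum>i=1..m. \<mu> i *\<^sub>R gradient (f i) x)
          + (\<Sum>i=1..a. lam i *\<^sub>R gradient (g i) x) = 0 \<and>
        (\<forall>i\<in>{1..a}. g i x \<le> 0 \<and> lam i * g i x = 0) \<and>
        (\<forall>i\<in>{1..m}. f i x - f i xhat \<le> 0 \<and> \<mu> i * (f i x - f i xhat) = 0))"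

definition KKT_point_weighted_sum ::
  "nat \<Rightarrow> nat \<Rightarrow> (nat \<Rightarrow> real ^ 'n \<Rightarrow> real) \<Rightarrow> (nat \<Rightarrow> real ^ 'n \<Rightarrow> real) \<Rightarrow>
   (nat \<Rightarrow> real) \<Rightarrow> real ^ 'n \<Rightarrow> bool" where
  "KKT_point_weighted_sum m a f g w x \<longleftrightarrow>
     (\<exists>lam :: nat \<Rightarrow> real.
        (\<forall>i\<in>{1..a}. 0 \<le> lam i) \<and>
        (\<Sum>i=1..m. w i *\<^sub>R gradient (f i) x) + (\<Sum>i=1..a. lam i *\<^sub>R gradient (g i) x) = 0 \<and>
        (\<forall>i\<in>{1..a}. g i x \<le> 0 \<and> lam i * g i x = 0))"

definition Pareto_critical_point ::
  "nat \<Rightarrow> nat \<Rightarrow> (nat \<Rightarrow> real ^ 'n \<Rightarrow> real) \<Rightarrow> (nat \<Rightarrow> real ^ 'n \<Rightarrow> real) \<Rightarrow>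
   real ^ 'n \<Rightarrow> bool" where
  "Pareto_critical_point m a f g x \<longleftrightarrow>
     (\<exists>w :: nat \<Rightarrow> real.
        (\<forall>i\<in>{1..m}. 0 \<le> w i) \<and> (\<exists>i\<in>{1..m}. 0 < w i) \<and>
        KKT_point_weighted_sum m a f g w x)"

end

theory Submission
  imports Defs
begin

text \<open>Each bound \<open>f i x \<le> f i xhat\<close> has the same gradient as the objective
  \<open>f i\<close>, so in the stationarity equation of (P2) the multiplier terms of these bounds
  merge with the gradient of the summed objective. What results is stationarity of a weighted sum of
  the objectives, with the multipliers of the constraints \<open>g i\<close> carried over
  unchanged.\<close>

theorem theorem3p2p1:
  fixes m a :: nat
    and f g :: "nat \<Rightarrow> real ^ 'n \<Rightarrow> real"
    and xhat xstar :: "real ^ 'n"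
  assumes "m \<ge> 2"
    and "\<And>i. i \<in> {1..m} \<Longrightarrow> twice_continuously_differentiable (f i)"
    and "\<And>i. i \<in> {1..a} \<Longrightarrow> twice_continuously_differentiable (g i)"
    and "KKT_point_P2 m a f g xhat xstar"
  shows "Pareto_critical_point m a f g xstar"
proof -
  obtain \<mu> lam :: "nat \<Rightarrow> real" where
    \<mu>: "\<forall>i\<in>{1..m}. 0 \<le> \<mu> i" and
    lam: "\<forall>i\<in>{1..a}. 0 \<le> lam i" and
    stationary: "(\<Sum>i=1..m. gradient (f i) xstar) + (\<Sum>i=1..m. \<mu> i *\<^sub>R gradient (f i) xstar)
      + (\<Sum>i=1..a. lam i *\<^sub>R gradient (g i) xstar) = 0" and
    feasible: "\<forall>i\<in>{1..a}. g i xstar \<le> 0 \<and> lam i * g i xstar = 0"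
    using assms(4) unfolding KKT_point_P2_def by blast
  \<comment> \<open>The 1 is the coefficient of \<open>f i\<close> in the objective of (P2). It
    keeps every weight positive even if all \<open>\<mu> i\<close> vanish.\<close>
  define w where "w i = 1 + \<mu> i" for i
  have "(\<Sum>i=1..m. w i *\<^sub>R gradient (f i) xstar)
      = (\<Sum>i=1..m. gradient (f i) xstar) + (\<Sum>i=1..m. \<mu> i *\<^sub>R gradient (f i) xstar)"
    by (simp add: w_def scaleR_add_left sum.distrib)
  with lam stationary feasible have "KKT_point_weighted_sum m a f g w xstar"
    unfolding KKT_point_weighted_sum_def by (intro exI[of _ lam]) simp
  moreover have w_pos: "0 < w i" if "i \<in> {1..m}" for i
    using \<mu> that by (simp add: w_def add_pos_nonneg)
  moreover have "\<exists>i\<in>{1..m}. 0 < w i"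
    \<comment> \<open>Any index would do; 1 lies in the range because
      \<open>m \<ge> 2\<close>.\<close>
    using assms(1) by (intro bexI[of _ 1] w_pos) auto
  ultimately show ?thesis
    unfolding Pareto_critical_point_def by (intro exI[of _ w]) (auto intro: less_imp_le)
qed

end
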